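(* For every prime $n>2$, $\Psi(n)\le \frac{n-1}{2}$; that is, there is a permutation of $\mathbb{Z}_n$ whose graph contains at most $(n-1)/2$ collinear triples.
   Context: $\mathbb{Z}_n$ denotes the integers modulo $n$. A permutation of $\mathbb{Z}_n$ is a bijection $\sigma:\mathbb{Z}_n\to\mathbb{Z}_n$, and its graph is $\{(x,\sigma(x)) : x\in\mathbb{Z}_n\}\subset\mathbb{Z}_n\times\mathbb{Z}_n$. For $n$ prime, a set of points $X\subset\mathbb{Z}_n\times\mathbb{Z}_n$ is called collinear if there are $a,b,c\in\mathbb{Z}_n$ with $(a,b)\neq(0,0)$ such that every $(i,j)\in X$ lies on the line $\{(x,y)\in\mathbb{Z}_n\times\mathbb{Z}_n : ax+by=c\}$. A collinear triple is a collinear set of exactly three distinct points (triples are unordered). $\Psi(n)$ denotes the minimum, over all permutations $\sigma$ of $\mathbb{Z}_n$, of the number of collinear triples contained in the graph of $\sigma$. *)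

theory Defs
  imports "HOL-Number_Theory.Number_Theory" "HOL-Combinatorics.Permutations"
begin

text \<open>The integers modulo \<open>n\<close> are represented by the residues \<open>0, \<dots>, n - 1\<close>,
  and equality of computed values is congruence modulo \<open>n\<close>.\<close>

definition Zmod :: "nat \<Rightarrow> int set" where
  "Zmod n = {0..<int n}"

definition line :: "nat \<Rightarrow> int \<Rightarrow> int \<Rightarrow> int \<Rightarrow> (int \<times> int) set" where
  "line n a b c = {(x, y). x \<in> Zmod n \<and> y \<in> Zmod n \<and> [a * x + b * y = c] (mod int n)}"

definition collinear :: "nat \<Rightarrow> (int \<times> int) set \<Rightarrow> bool" where
  "collinear n X \<longleftrightarrow>
    (\<exists>a\<in>Zmod n. \<exists>b\<in>Zmod n. \<exists>c\<in>Zmod n. (a, b) \<noteq> (0, 0) \<and> X \<subseteq> line n a b c)"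

definition perm_graph :: "nat \<Rightarrow> (int \<Rightarrow> int) \<Rightarrow> (int \<times> int) set" where
  "perm_graph n \<sigma> = {(x, \<sigma> x) | x. x \<in> Zmod n}"

definition collinear_triples :: "nat \<Rightarrow> (int \<times> int) set \<Rightarrow> (int \<times> int) set set" where
  "collinear_triples n S = {T. T \<subseteq> S \<and> card T = 3 \<and> collinear n T}"

definition Psi :: "nat \<Rightarrow> nat" where
  "Psi n = Min ((\<lambda>\<sigma>. card (collinear_triples n (perm_graph n \<sigma>))) ` {\<sigma>. \<sigma> permutes Zmod n})"

text \<open>The sets whose cardinality and minimum are taken are finite, and the latter is nonempty,
  so neither \<open>card\<close> nor \<open>Min\<close> takes a default value.\<close>

lemma finite_collinear_triples: "finite (collinear_triples n (perm_graph n \<sigma>))"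
proof -
  have "perm_graph n \<sigma> = (\<lambda>x. (x, \<sigma> x)) ` Zmod n"
    by (auto simp: perm_graph_def)
  then have "finite (Pow (perm_graph n \<sigma>))"
    by (simp add: Zmod_def)
  moreover have "collinear_triples n (perm_graph n \<sigma>) \<subseteq> Pow (perm_graph n \<sigma>)"
    by (auto simp: collinear_triples_def)
  ultimately show ?thesis
    by (rule rev_finite_subset)
qed

lemma Psi_le_iff:
  "Psi n \<le> k \<longleftrightarrow>
    (\<exists>\<sigma>. \<sigma> permutes Zmod n \<and> card (collinear_triples n (perm_graph n \<sigma>)) \<le> k)"
proof -
  have "finite {\<sigma>. \<sigma> permutes Zmod n}"
    by (rule finite_permutations) (simp add: Zmod_def)
  moreover have "{\<sigma>. \<sigma> permutes Zmod n} \<noteq> {}"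
    using permutes_id by blast
  ultimately show ?thesis
    unfolding Psi_def by (subst Min_le_iff) auto
qed

end

theory Submission
  imports Defs
begin

text \<open>
  The permutation is inversion, \<open>x \<mapsto> x\<^sup>-\<^sup>1\<close>, with \<open>0\<close> fixed.  Apart from the origin, its graph
  is the hyperbola \<open>x * y = 1\<close>.  A line \<open>a * x + b * y = c\<close> meets the hyperbola where
  \<open>a * x\<^sup>2 - c * x + b = 0\<close>, and a nonzero quadratic over a field has at most two roots; so every
  collinear triple contains the origin (\<open>origin_in_collinear_triple\<close>).  On a line through the
  origin \<open>c = 0\<close>, and the equation becomes \<open>a * x\<^sup>2 + b = 0\<close>, whose two roots are opposite.  Every
  collinear triple therefore lies over \<open>{0, x, -x}\<close> for some \<open>x \<noteq> 0\<close>
  (\<open>collinear_triple_opposite\<close>), and the \<open>n - 1\<close> nonzero residues form \<open>(n - 1) / 2\<close> pairs of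
  opposite elements.
\<close>

text \<open>The difference of the equations for \<open>x\<close> and \<open>t\<close> is divisible by \<open>x - t\<close>, which leaves
  \<open>a * (x + t) + b = 0\<close>; comparing \<open>t = y\<close> with \<open>t = z\<close> gives \<open>a = 0\<close>.\<close>

lemma prime_dvd_quadratic_three_roots:
  fixes p a b c x y z :: int
  assumes p: "prime p"
    and root: "p dvd a * x\<^sup>2 + b * x + c" "p dvd a * y\<^sup>2 + b * y + c" "p dvd a * z\<^sup>2 + b * z + c"
    and distinct: "\<not> p dvd x - y" "\<not> p dvd x - z" "\<not> p dvd y - z"
  shows "p dvd a" "p dvd b" "p dvd c"
proof -
  have slope: "p dvd a * (x + t) + b"
    if "p dvd a * t\<^sup>2 + b * t + c" and "\<not> p dvd x - t" for t
  proof -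
    have "p dvd (a * x\<^sup>2 + b * x + c) - (a * t\<^sup>2 + b * t + c)"
      using root(1) that(1) by (rule dvd_diff)
    also have "\<dots> = (x - t) * (a * (x + t) + b)"
      by (simp add: algebra_simps power2_eq_square)
    finally show ?thesis
      using p that(2) by (simp add: prime_dvd_mult_iff)
  qed
  have "p dvd (a * (x + y) + b) - (a * (x + z) + b)"
    using root distinct by (intro dvd_diff slope)
  also have "\<dots> = a * (y - z)"
    by (simp add: algebra_simps)
  finally show a: "p dvd a"
    using p distinct(3) by (simp add: prime_dvd_mult_iff)
  show b: "p dvd b"
    using slope[OF root(2) distinct(1)] a by (simp add: dvd_add_right_iff)
  show "p dvd c"
    using root(1) a b by (simp add: dvd_add_right_iff)
qed

lemma dvd_diff_Zmod_iff:
  assumes "x \<in> Zmod n" "y \<in> Zmod n"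
  shows "int n dvd x - y \<longleftrightarrow> x = y"
  using assms cong_less_imp_eq_int[of x "int n" y]
  by (auto simp: Zmod_def cong_iff_dvd_diff)

lemma coprime_Zmod:
  assumes "prime n" "x \<in> Zmod n" "x \<noteq> 0"
  shows "coprime x (int n)"
proof -
  have "\<not> int n dvd x"
    using assms by (auto simp: Zmod_def dest: zdvd_imp_le)
  then show ?thesis
    using assms(1) prime_imp_coprime[of "int n" x] by (simp add: coprime_commute)
qed

text \<open>The value at \<open>0\<close> is \<open>0\<close>, the default of \<open>modular_inverse\<close>; integers that are not residues
  are fixed, as \<open>permutes\<close> demands.\<close>

definition inversion :: "nat \<Rightarrow> int \<Rightarrow> int" where
  "inversion n x = (if x \<in> Zmod n then modular_inverse (int n) x else x)"

lemma inversion_0: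
  assumes "prime n"
  shows "inversion n 0 = 0"
  using assms prime_gt_1_nat[OF assms] by (simp add: inversion_def Zmod_def)

lemma inversion_in_Zmod: "x \<in> Zmod n \<Longrightarrow> inversion n x \<in> Zmod n"
  by (auto simp: inversion_def Zmod_def modular_inverse_int_nonneg modular_inverse_int_less)

lemma inversion_cong:
  assumes "prime n" "x \<in> Zmod n" "x \<noteq> 0"
  shows "[x * inversion n x = 1] (mod int n)"
  using assms cong_modular_inverse1[OF coprime_Zmod[OF assms]] by (simp add: inversion_def)

lemma inversion_involution:
  assumes "prime n" "x \<in> Zmod n"
  shows "inversion n (inversion n x) = x"
proof (cases "x = 0")
  case True
  then show ?thesis
    using assms by (simp add: inversion_0)
next
  case False
  then have "modular_inverse (int n) (inversion n x) = x"
    using assms inversion_cong[of n x]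
    by (intro modular_inverse_int_eqI) (auto simp: Zmod_def mult.commute)
  then show ?thesis
    using inversion_in_Zmod[OF assms(2)] by (simp add: inversion_def)
qed

lemma inversion_permutes:
  assumes "prime n"
  shows "inversion n permutes Zmod n"
proof (rule bij_imp_permutes)
  show "bij_betw (inversion n) (Zmod n) (Zmod n)"
    by (rule bij_betw_byWitness[where f' = "inversion n"])
      (auto simp: inversion_involution[OF assms] inversion_in_Zmod)
qed (simp add: inversion_def)

text \<open>Multiplying the equation of the line by \<open>x\<close> turns it into a quadratic in the abscissa alone.\<close>

lemma hyperbola_line_quadratic:
  assumes n: "prime n" and x: "x \<in> Zmod n" "x \<noteq> 0"
    and on_line: "(x, inversion n x) \<in> line n a b c"
  shows "int n dvd a * x\<^sup>2 + (- c) * x + b"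
proof -
  have "int n dvd x * (a * x + b * inversion n x - c)"
    using on_line by (simp add: line_def cong_iff_dvd_diff)
  moreover have "int n dvd b * (x * inversion n x - 1)"
    using inversion_cong[OF n x] by (simp add: cong_iff_dvd_diff)
  ultimately have "int n dvd x * (a * x + b * inversion n x - c) - b * (x * inversion n x - 1)"
    by (rule dvd_diff)
  also have "\<dots> = a * x\<^sup>2 + (- c) * x + b"
    by (simp add: algebra_simps power2_eq_square)
  finally show ?thesis .
qed

lemma origin_in_collinear_triple:
  assumes n: "prime n"
    and in_Zmod: "x \<in> Zmod n" "y \<in> Zmod n" "z \<in> Zmod n"
    and distinct: "x \<noteq> y" "x \<noteq> z" "y \<noteq> z"
    and collinear: "collinear n ((\<lambda>t. (t, inversion n t)) ` {x, y, z})"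
  shows "0 \<in> {x, y, z}"
proof (rule ccontr)
  assume nonzero: "0 \<notin> {x, y, z}"
  obtain a b c where ab: "a \<in> Zmod n" "b \<in> Zmod n" "(a, b) \<noteq> (0, 0)"
    and on_line: "(\<lambda>t. (t, inversion n t)) ` {x, y, z} \<subseteq> line n a b c"
    using collinear unfolding collinear_def by blast
  have quadratic: "int n dvd a * t\<^sup>2 + (- c) * t + b" if "t \<in> {x, y, z}" for t
    using that nonzero on_line in_Zmod by (intro hyperbola_line_quadratic[OF n]) auto
  have prime: "prime (int n)"
    using n by simp
  have incongruent: "\<not> int n dvd x - y" "\<not> int n dvd x - z" "\<not> int n dvd y - z"
    using distinct by (simp_all add: dvd_diff_Zmod_iff in_Zmod)
  have roots: "int n dvd a * x\<^sup>2 + (- c) * x + b" "int n dvd a * y\<^sup>2 + (- c) * y + b"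
    "int n dvd a * z\<^sup>2 + (- c) * z + b"
    by (rule quadratic; simp)+
  have "int n dvd a" "int n dvd b"
    by (rule prime_dvd_quadratic_three_roots[OF prime roots incongruent])+
  then show False
    using ab dvd_diff_Zmod_iff[of _ n 0] by (auto simp: Zmod_def)
qed

lemma collinear_with_origin_opposite:
  assumes n: "prime n"
    and in_Zmod: "x \<in> Zmod n" "y \<in> Zmod n"
    and nonzero: "x \<noteq> 0" "y \<noteq> 0" and "x \<noteq> y"
    and collinear: "collinear n ((\<lambda>t. (t, inversion n t)) ` {0, x, y})"
  shows "y = int n - x"
proof -
  obtain a b c where ab: "a \<in> Zmod n" "b \<in> Zmod n" "(a, b) \<noteq> (0, 0)"
    and on_line: "(\<lambda>t. (t, inversion n t)) ` {0, x, y} \<subseteq> line n a b c"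
    using collinear unfolding collinear_def by blast
  have "(0, 0) \<in> line n a b c"
    using on_line by (simp add: inversion_0[OF n])
  then have c: "int n dvd c"
    by (simp add: line_def cong_iff_dvd_diff)
  have root: "int n dvd a * t\<^sup>2 + b" if "t \<in> {x, y}" for t
  proof -
    have "int n dvd a * t\<^sup>2 + (- c) * t + b"
      using that nonzero on_line in_Zmod by (intro hyperbola_line_quadratic[OF n]) auto
    then have "int n dvd (a * t\<^sup>2 + (- c) * t + b) + c * t"
      by (rule dvd_add) (simp add: c)
    then show ?thesis
      by (simp add: algebra_simps)
  qed
  have "\<not> int n dvd a"
  proof
    assume a: "int n dvd a"
    then have "int n dvd b"
      using root[of x] by (simp add: dvd_add_right_iff)
    with a show False
      using ab dvd_diff_Zmod_iff[of _ n 0] by (auto simp: Zmod_def)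
  qed
  moreover have "int n dvd (a * x\<^sup>2 + b) - (a * y\<^sup>2 + b)"
    by (intro dvd_diff root) auto
  then have "int n dvd a * ((x - y) * (x + y))"
    by (simp add: algebra_simps power2_eq_square)
  ultimately have "int n dvd x + y"
    using n \<open>x \<noteq> y\<close> dvd_diff_Zmod_iff[OF in_Zmod] by (simp add: prime_dvd_mult_iff)
  then have "int n dvd y - (int n - x)"
    using dvd_diff[of "int n" "x + y" "int n"] by (simp add: algebra_simps)
  moreover have "int n - x \<in> Zmod n"
    using in_Zmod nonzero by (auto simp: Zmod_def)
  ultimately show ?thesis
    using dvd_diff_Zmod_iff[OF in_Zmod(2)] by blast
qed

text \<open>One of two opposite nonzero residues is at most \<open>(n - 1) / 2\<close>; it serves as the representative
  of the pair.\<close>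

lemma collinear_triple_opposite:
  assumes n: "prime n"
    and T: "T \<in> collinear_triples n (perm_graph n (inversion n))"
  obtains x where "x \<in> {1..(int n - 1) div 2}"
    and "T = (\<lambda>t. (t, inversion n t)) ` {0, x, int n - x}"
proof -
  let ?g = "\<lambda>t. (t, inversion n t)"
  have "T \<subseteq> ?g ` Zmod n"
    using T by (auto simp: collinear_triples_def perm_graph_def)
  then obtain A where A: "A \<subseteq> Zmod n" "T = ?g ` A"
    by (auto simp: subset_image_iff)
  have "inj_on ?g A"
    by (rule inj_onI) simp
  then have "card A = 3"
    using T A(2) by (simp add: collinear_triples_def card_image)
  then obtain x y z where xyz: "A = {x, y, z}" "x \<noteq> y" "y \<noteq> z" "x \<noteq> z"
    by (auto simp: card_3_iff)
  have "collinear n (?g ` A)"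
    using T A(2) by (simp add: collinear_triples_def)
  then have "0 \<in> A"
    using origin_in_collinear_triple[OF n, of x y z] A(1) xyz by simp
  then obtain u v where uv: "A = {0, u, v}" "u \<noteq> 0" "v \<noteq> 0" "u \<noteq> v"
    using xyz by blast
  then have v: "v = int n - u"
    using collinear_with_origin_opposite[OF n, of u v] A(1) \<open>collinear n (?g ` A)\<close> by simp
  have bounds: "u \<in> {1..<int n}" "v \<in> {1..<int n}"
    using uv A(1) by (auto simp: Zmod_def)
  have "u \<in> {1..(int n - 1) div 2} \<or> v \<in> {1..(int n - 1) div 2}"
    using bounds v uv(4) by auto
  then show thesis
  proof
    assume "u \<in> {1..(int n - 1) div 2}"
    then show thesis
      using that[of u] A(2) uv(1) v by simp
  next
    assume "v \<in> {1..(int n - 1) div 2}"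
    moreover have "A = {0, v, int n - v}"
      using uv(1) v by auto
    ultimately show thesis
      using that[of v] A(2) by simp
  qed
qed

theorem proposition4:
  fixes n :: nat
  assumes "prime n" and "n > 2"
  shows "real (Psi n) \<le> (real n - 1) / 2"
proof -
  let ?F = "\<lambda>x. (\<lambda>t. (t, inversion n t)) ` {0, x, int n - x}"
  let ?I = "{1..(int n - 1) div 2}"
  have "collinear_triples n (perm_graph n (inversion n)) \<subseteq> ?F ` ?I"
    by (blast elim: collinear_triple_opposite[OF assms(1)])
  then have "card (collinear_triples n (perm_graph n (inversion n))) \<le> card ?I"
    by (intro surj_card_le) simp_all
  then have "Psi n \<le> card ?I"
    using inversion_permutes[OF assms(1)] by (auto simp: Psi_le_iff)
  also have "card ?I = (n - 1) div 2"
    using assms(2) by simp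
  finally have "2 * Psi n \<le> n - 1"
    by linarith
  then have "2 * real (Psi n) \<le> real n - 1"
    using assms(2) by linarith
  then show ?thesis
    by simp
qed

end
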